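(* For $n \ge 1$ let $$p'_n = \sum_{i=0}^{2n} \frac{(2n)!}{i!}, \qquad q'_n = \sum_{i=0}^{2n} (-1)^i \frac{(2n)!}{i!}.$$ Then $\left\{\frac{p'_n}{q'_n}\right\}_{n\ge1}$ is a nice rational approximation of $e^2$, i.e. $0 < |q'_n e^2 - p'_n|$ for all $n$ and $|q'_n e^2 - p'_n| \to 0$ as $n \to \infty$.
   Context: $e = \sum_{k=0}^{\infty} \frac{1}{k!}$. *)

theory Defs
  imports Complex_Main
begin

text \<open>
  Sequences are indexed by \<open>n \<ge> 1\<close>; the value at \<open>0\<close> is irrelevant. The first three conjuncts say that
  the terms \<open>p n / q n\<close> are well-formed fractions of integers. Without integrality the
  approximation condition would carry no arithmetic content.
\<close>
definition nice_rational_approximation ::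
  "(nat \<Rightarrow> real) \<Rightarrow> (nat \<Rightarrow> real) \<Rightarrow> real \<Rightarrow> bool" where
  "nice_rational_approximation p q \<alpha> \<longleftrightarrow>
     (\<forall>n\<ge>1. p n \<in> \<int> \<and> q n \<in> \<int> \<and> q n \<noteq> 0 \<and> 0 < \<bar>q n * \<alpha> - p n\<bar>) \<and>
     (\<lambda>n. \<bar>q n * \<alpha> - p n\<bar>) \<longlonglongrightarrow> 0"

definition p' :: "nat \<Rightarrow> real" where
  "p' n = (\<Sum>i=0..2*n. fact (2*n) / fact i)"

definition q' :: "nat \<Rightarrow> real" where
  "q' n = (\<Sum>i=0..2*n. (-1) ^ i * (fact (2*n) / fact i))"

end

(* With N = 2n, Taylor's formula with Lagrange remainder at 1 and at -1 gives
   p'_n = N! e - exp s / (N + 1) and q'_n = N! / e + exp t / (N + 1) with |s|, |t| <= 1; the second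
   remainder has a plus sign because N + 1 is odd. In q'_n e^2 - p'_n the main terms cancel and
   what is left, (exp t e^2 + exp s) / (N + 1), is positive and tends to 0. *)
theory Submission
  imports Defs
begin

lemma fact_div_fact_in_Ints:
  assumes "i \<le> m"
  shows "(fact m / fact i :: real) \<in> \<int>"
proof -
  \<comment> \<open>Every nonzero real divides every real, so the integer quotient has to come from
    divisibility in the naturals.\<close>
  obtain k where "(fact m :: nat) = fact i * k"
    using fact_dvd[OF assms] by (auto elim: dvdE)
  then have "(fact m :: real) = fact i * real k"
    by (metis of_nat_fact of_nat_mult)
  then show ?thesis
    by simp
qed

lemma p'_in_Ints: "p' n \<in> \<int>"
  unfolding p'_def by (intro Ints_sum fact_div_fact_in_Ints) auto

lemma q'_in_Ints: "q' n \<in> \<int>"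
  unfolding q'_def
  by (intro Ints_sum Ints_mult Ints_power Ints_minus Ints_1 fact_div_fact_in_Ints) auto

text \<open>Multiplying Taylor's formula by \<open>fact m\<close> makes the coefficients integers
  and shrinks the denominator of the Lagrange remainder from \<open>fact (Suc m)\<close> to
  \<open>Suc m\<close>. Leaving \<open>x\<close> general serves both \<open>x = 1\<close> and
  \<open>x = -1\<close>.\<close>

lemma fact_times_exp:
  fixes x :: real
  obtains t where "\<bar>t\<bar> \<le> \<bar>x\<bar>"
    and "fact m * exp x = (\<Sum>i=0..m. x ^ i * (fact m / fact i)) + exp t * x ^ Suc m / real (Suc m)"
proof -
  \<comment> \<open>Order \<open>Suc m\<close> makes the Taylor sum run up to degree
    \<open>m\<close>, where \<open>fact m / fact i\<close> is still an integer.\<close>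
  obtain t where t: "\<bar>t\<bar> \<le> \<bar>x\<bar>"
    and e: "exp x = (\<Sum>i<Suc m. x ^ i / fact i) + exp t / fact (Suc m) * x ^ Suc m"
    using Maclaurin_exp_le[of x "Suc m"] by blast
  have "fact m * exp x = fact m * (\<Sum>i<Suc m. x ^ i / fact i)
      + fact m * (exp t / fact (Suc m) * x ^ Suc m)"
    unfolding e by (rule distrib_left)
  also have "fact m * (\<Sum>i<Suc m. x ^ i / fact i) = (\<Sum>i=0..m. x ^ i * (fact m / fact i))"
    by (simp add: sum_distrib_left lessThan_Suc_atMost atMost_atLeast0 mult.commute del: sum.lessThan_Suc)
  also have "fact m * (exp t / fact (Suc m) * x ^ Suc m) = exp t * x ^ Suc m / real (Suc m)"
    by (simp add: fact_Suc del: of_nat_Suc power_Suc)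
  finally show ?thesis
    using t that by blast
qed

text \<open>Only the upper bound on \<open>s\<close> is kept: \<open>exp s\<close> is positive
  anyway, and the later estimate needs just \<open>exp s \<le> exp 1\<close>.\<close>

lemma p'_eq:
  obtains s where "s \<le> 1" "p' n = fact (2*n) * exp 1 - exp s / real (Suc (2*n))"
proof -
  obtain s :: real where "\<bar>s\<bar> \<le> \<bar>1\<bar>"
    and "fact (2*n) * exp 1 = (\<Sum>i=0..2*n. 1 ^ i * (fact (2*n) / fact i))
      + exp s * 1 ^ Suc (2*n) / real (Suc (2*n))"
    by (rule fact_times_exp)
  then show ?thesis
    by (intro that[of s]) (auto simp: p'_def)
qed

lemma q'_eq:
  obtains t where "t \<le> 1" "q' n = fact (2*n) * exp (-1) + exp t / real (Suc (2*n))"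
proof -
  obtain t :: real where "\<bar>t\<bar> \<le> \<bar>-1\<bar>"
    and "fact (2*n) * exp (-1) = (\<Sum>i=0..2*n. (-1) ^ i * (fact (2*n) / fact i))
      + exp t * (-1) ^ Suc (2*n) / real (Suc (2*n))"
    by (rule fact_times_exp)
  then show ?thesis
    by (intro that[of t]) (auto simp: q'_def)
qed

text \<open>The alternating sum hides its sign, but in the Taylor form both summands are
  positive.\<close>

lemma q'_pos: "0 < q' n"
proof -
  obtain t where "q' n = fact (2*n) * exp (-1) + exp t / real (Suc (2*n))"
    by (rule q'_eq)
  then show ?thesis
    by (simp add: add_pos_pos)
qed

lemma q'_exp_minus_p'_bounds:
  "0 < q' n * (exp 1)\<^sup>2 - p' n"
  "q' n * (exp 1)\<^sup>2 - p' n \<le> (exp 3 + exp 1) / real (Suc (2*n))"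
proof -
  obtain s where s: "s \<le> 1" "p' n = fact (2*n) * exp 1 - exp s / real (Suc (2*n))"
    by (rule p'_eq)
  obtain t where t: "t \<le> 1" "q' n = fact (2*n) * exp (-1) + exp t / real (Suc (2*n))"
    by (rule q'_eq)
  \<comment> \<open>The first identity cancels the two terms of size \<open>fact (2*n)\<close>. The
    second absorbs the factor into the exponent, and \<open>t + 2 \<le> 3\<close> explains the
    constant \<open>exp 3\<close> in the bound.\<close>
  have "exp (-1) * (exp 1)\<^sup>2 = (exp 1 :: real)" and "exp t * (exp 1)\<^sup>2 = exp (t + 2)"
    by (simp_all add: power2_eq_square flip: exp_add)
  then have eq: "q' n * (exp 1)\<^sup>2 - p' n = (exp (t + 2) + exp s) / real (Suc (2*n))"
    unfolding s t by (simp add: distrib_right add_divide_distrib mult.assoc del: of_nat_Suc)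
  show "0 < q' n * (exp 1)\<^sup>2 - p' n"
    unfolding eq by (intro divide_pos_pos add_pos_pos) auto
  show "q' n * (exp 1)\<^sup>2 - p' n \<le> (exp 3 + exp 1) / real (Suc (2*n))"
    unfolding eq using s t by (intro divide_right_mono add_mono) auto
qed

lemma q'_exp_minus_p'_tendsto_0: "(\<lambda>n. q' n * (exp 1)\<^sup>2 - p' n) \<longlonglongrightarrow> 0"
proof (rule tendsto_sandwich)
  show "\<forall>\<^sub>F n in sequentially. 0 \<le> q' n * (exp 1)\<^sup>2 - p' n"
    by (intro always_eventually allI less_imp_le q'_exp_minus_p'_bounds)
  show "\<forall>\<^sub>F n in sequentially. q' n * (exp 1)\<^sup>2 - p' n \<le> (exp 3 + exp 1) / real (Suc (2*n))"
    by (intro always_eventually allI q'_exp_minus_p'_bounds)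
  \<comment> \<open>The bound is the null sequence \<open>c / real n\<close> taken along the
    subsequence of indices \<open>Suc (2*n)\<close>.\<close>
  have "filterlim (\<lambda>n. Suc (2*n)) sequentially sequentially"
    by (intro filterlim_subseq) (auto simp: strict_mono_def)
  then show "(\<lambda>n. (exp 3 + exp 1) / real (Suc (2*n))) \<longlonglongrightarrow> 0"
    by (rule filterlim_compose[OF lim_const_over_n])
qed simp

theorem theorem3p2p6:
  "nice_rational_approximation p' q' ((exp 1)\<^sup>2)"
  unfolding nice_rational_approximation_def
proof (intro conjI allI impI)
  fix n
  show "p' n \<in> \<int>" "q' n \<in> \<int>"
    by (rule p'_in_Ints q'_in_Ints)+
  show "q' n \<noteq> 0"
    using q'_pos[of n] by simp
  show "0 < \<bar>q' n * (exp 1)\<^sup>2 - p' n\<bar>"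
    using q'_exp_minus_p'_bounds(1)[of n] by simp
next
  show "(\<lambda>n. \<bar>q' n * (exp 1)\<^sup>2 - p' n\<bar>) \<longlonglongrightarrow> 0"
    by (rule tendsto_rabs_zero[OF q'_exp_minus_p'_tendsto_0])
qed

end
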